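(* Let $F_\tau$ be the Gromov boundary of a supercritical Galton-Watson tree with bounded offspring distribution. There exists $C>0$ such that, conditioned on non-extinction, almost surely $$\dim_{\mathrm A}^{\phi}F_\tau=\dim_{\mathrm A}F_\tau$$ for all dimension functions $\phi$ satisfying $\phi(x)\le C\,\dfrac{\log|\log x|}{|\log x|}$ for all sufficiently small $x>0$.
   Context: Here $\log$ is the natural logarithm. Dimension function: a function $\phi$ with values in $(0,\infty)$ such that $x\mapsto\phi(x)$ and $x\mapsto\phi(x)|\log x|$ are both monotone on $(0,1)$. Generalised Assouad spectrum: for a metric space $F$ let $N_r(E)$ be the minimal number of balls of radius at most $r$ needed to cover $E$, and let $B(x,R)$ be the ball of radius $R$ centred at $x$. For a dimension function $\phi$, $\dim_{\mathrm A}^{\phi}F$ is the infimum of all $s$ for which there is a constant $C'>0$ such that for all $0<R<1$, with $r=R^{1+\phi(R)}$, one has $\sup_{x\in F}N_r(F\cap B(x,R))\le C'(R/r)^s=C' R^{-\phi(R)s}$. The Assouad dimension $\dim_{\mathrm A}F$ is the infimum of all $s$ for which there is $C'>0$ such that $\sup_{x\in F}N_r(F\cap B(x,R))\le C'(R/r)^s$ for all $0<r\le R<1$. Galton-Watson tree: $X$ is a random variable taking values in $\{0,1,\dots,N\}$, where $N$ is the maximal integer with $\theta_N>0$ and $\theta_j=\mathbb{P}\{X=j\}$. Starting from a single root, every node is given a random number of children with the law of $X$, independently of all other nodes. The process is supercritical: $m=\mathbb{E}(X)=\sum_{k}k\,\theta_k>1$. We condition on non-extinction, i.e. on the tree being infinite.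 The Gromov boundary $F_\tau$ is the set of infinite descending paths starting at the root, with metric $d(x,y)=2^{-|x\wedge y|}$, where $|x\wedge y|$ is the level of the least common ancestor (last common node) of $x$ and $y$. It is known that almost surely (conditioned on non-extinction) $\dim_{\mathrm A}F_\tau=\log N/\log 2$.
   Formalization: The formal statement additionally requires φ(x)|log x| → ∞ as x → 0; without it the claim fails, e.g. for φ(x) = 1/|log x|, where R/r = e for all R, so every s is admissible, while the Assouad dimension is log N/log 2 > 0. *)

theory Defs
  imports "HOL-Probability.Probability"
begin

(* The balls are open balls of the metric space (M, d), hence centred in M.
   The infimum of the empty set is \<infinity> in enat. *)
definition covering_number :: "'a set \<Rightarrow> ('a \<Rightarrow> 'a \<Rightarrow> real) \<Rightarrow> real \<Rightarrow> 'a set \<Rightarrow> enat" where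
  "covering_number M d r E =
     Inf {enat (card \<B>) | \<B>. finite \<B>
            \<and> \<B> \<subseteq> {Metric_space.mball M d x \<rho> | x \<rho>. x \<in> M \<and> 0 < \<rho> \<and> \<rho> \<le> r}
            \<and> E \<subseteq> \<Union>\<B>}"

(* The mball below is already intersected with the carrier M. *)
definition local_covering_number ::
    "'a set \<Rightarrow> ('a \<Rightarrow> 'a \<Rightarrow> real) \<Rightarrow> real \<Rightarrow> real \<Rightarrow> enat" where
  "local_covering_number M d R r =
     (SUP x\<in>M. covering_number M d r (Metric_space.mball M d x R))"

definition assouad_dim :: "'a set \<Rightarrow> ('a \<Rightarrow> 'a \<Rightarrow> real) \<Rightarrow> ereal" where
  "assouad_dim M d =
     Inf {ereal s | s. \<exists>C'>0. \<forall>R r. 0 < r \<and> r \<le> R \<and> R < 1 \<longrightarrow>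
            ereal_of_enat (local_covering_number M d R r) \<le> ereal (C' * (R / r) powr s)}"

definition dimension_function :: "(real \<Rightarrow> real) \<Rightarrow> bool" where
  "dimension_function \<phi> \<longleftrightarrow>
     (\<forall>x\<in>{0<..<1}. 0 < \<phi> x)
     \<and> (mono_on {0<..<1} \<phi> \<or> antimono_on {0<..<1} \<phi>)
     \<and> (mono_on {0<..<1} (\<lambda>x. \<phi> x * \<bar>ln x\<bar>) \<or> antimono_on {0<..<1} (\<lambda>x. \<phi> x * \<bar>ln x\<bar>))"

(* As R / r = exp (\<phi> R * \<bar>ln R\<bar>), this value carries information about small scales only if
   \<phi> R * \<bar>ln R\<bar> tends to infinity as R tends to 0. If that quantity is bounded on (0, 1), as
   for \<phi> R = 1 / \<bar>ln R\<bar>, then on a doubling space every real s is admissible and the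
   infimum is -\<infinity>. *)
definition assouad_dim_at ::
    "(real \<Rightarrow> real) \<Rightarrow> 'a set \<Rightarrow> ('a \<Rightarrow> 'a \<Rightarrow> real) \<Rightarrow> ereal" where
  "assouad_dim_at \<phi> M d =
     Inf {ereal s | s. \<exists>C'>0. \<forall>R. 0 < R \<and> R < 1 \<longrightarrow>
            (let r = R powr (1 + \<phi> R) in
             ereal_of_enat (local_covering_number M d R r) \<le> ereal (C' * (R / r) powr s))}"

(* Ulam-Harris labelling: a node is the list of the birth ranks along its ancestral line, and
   c v is the number of children of v. *)
inductive_set gw_tree :: "(nat list \<Rightarrow> nat) \<Rightarrow> nat list set" for c :: "nat list \<Rightarrow> nat" where
  root: "[] \<in> gw_tree c"
| child: "v \<in> gw_tree c \<Longrightarrow> k < c v \<Longrightarrow> v @ [k] \<in> gw_tree c"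

definition gromov_boundary :: "nat list set \<Rightarrow> (nat \<Rightarrow> nat) set" where
  "gromov_boundary T = {x. \<forall>n. map x [0..<n] \<in> T}"

(* Meaningful only for x \<noteq> y. *)
definition meet_level :: "(nat \<Rightarrow> nat) \<Rightarrow> (nat \<Rightarrow> nat) \<Rightarrow> nat" where
  "meet_level x y = (GREATEST n. map x [0..<n] = map y [0..<n])"

definition gromov_dist :: "(nat \<Rightarrow> nat) \<Rightarrow> (nat \<Rightarrow> nat) \<Rightarrow> real" where
  "gromov_dist x y = (if x = y then 0 else 2 powr (- real (meet_level x y)))"

lemma meet_level_agree_iff:
  assumes "x \<noteq> y"
  shows "(\<forall>i<n. x i = y i) \<longleftrightarrow> n \<le> meet_level x y"
proof -
  let ?P = "\<lambda>n. map x [0..<n] = map y [0..<n]"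
  have P: "?P n \<longleftrightarrow> (\<forall>i<n. x i = y i)" for n by (auto simp: list_eq_iff_nth_eq)
  obtain k where k: "x k \<noteq> y k" using assms by blast
  have bd: "n \<le> k" if "?P n" for n using that k P[of n] by (meson not_le)
  have "?P (meet_level x y)"
    unfolding meet_level_def by (rule GreatestI_nat[of ?P 0 k]) (use bd in auto)
  moreover have "n \<le> meet_level x y" if "?P n" for n
    unfolding meet_level_def by (rule Greatest_le_nat[of ?P n k]) (use bd that in auto)
  ultimately show ?thesis unfolding P by (meson order_less_le_trans)
qed

lemma gromov_dist_le_iff:
  "gromov_dist x y \<le> 2 powr (- real n) \<longleftrightarrow> (\<forall>i<n. x i = y i)"
  using meet_level_agree_iff[of x y n] by (auto simp: gromov_dist_def)

lemma Metric_space_gromov: "Metric_space S gromov_dist"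
proof
  fix x y z
  show "0 \<le> gromov_dist x y" by (simp add: gromov_dist_def)
  show "gromov_dist x y = gromov_dist y x"
    by (simp add: gromov_dist_def meet_level_def eq_commute)
  show "gromov_dist x y = 0 \<longleftrightarrow> x = y" by (simp add: gromov_dist_def)
  show "gromov_dist x z \<le> gromov_dist x y + gromov_dist y z"
  proof (cases "x = y \<or> y = z")
    case False
    let ?n = "min (meet_level x y) (meet_level y z)"
    have "\<forall>i<?n. x i = z i"
      using False meet_level_agree_iff[of x y ?n] meet_level_agree_iff[of y z ?n] by simp
    then have "gromov_dist x z \<le> 2 powr (- real ?n)" by (simp add: gromov_dist_le_iff)
    also have "\<dots> \<le> gromov_dist x y + gromov_dist y z"
      using False by (simp add: gromov_dist_def min_def)
    finally show ?thesis .
  qed (auto simp: gromov_dist_def)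
qed

end

theory Submission
  imports Defs "HOL-Real_Asymp.Real_Asymp"
begin

text \<open>
  Let \<open>N\<close> be the maximal offspring number. All nodes have at most \<open>N\<close> children, so the Assouad
  dimension is at most \<open>log 2 N\<close>, and \<open>assouad_dim_at \<phi>\<close> never exceeds it. For the reverse bound
  it suffices that, almost surely on survival, for infinitely many levels \<open>n\<close> some node of level
  \<open>n\<close> has a full \<open>N\<close>-ary subtree of depth about \<open>c * ln n\<close> with surviving leaves: the scales
  \<open>R = 2 powr (1 - n)\<close> then already exclude every \<open>s < log 2 N\<close>.

  A fixed node has such a subtree of depth \<open>K\<close> with probability at least \<open>a ^ ((N + 1) ^ K)\<close>, which
  for small \<open>c\<close> is only \<open>exp (- O(sqrt n))\<close>. With \<open>f\<close> the generating function, level \<open>n\<close> contains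
  no such node with probability \<open>f\<close> iterated \<open>n\<close> times at one minus this number; as
  \<open>1\<close> is a repelling fixed point of \<open>f\<close>, this stays away from \<open>1\<close>. Hence the failure probability \<open>y\<close> of
  the event \<open>infinitely often\<close> is less than \<open>1\<close>. The event is inherited from child subtrees, so
  \<open>y \<le> f y\<close>, and strict convexity of \<open>f\<close> forces \<open>y\<close> to be the extinction probability.
\<close>

section \<open>Trees and full subtrees\<close>

text \<open>The tree below \<open>v\<close> is encoded by its shifted offspring function, so that
  \<open>gw_tree\<close> applies to it again.\<close>

definition subtree :: "nat list \<Rightarrow> (nat list \<Rightarrow> nat) \<Rightarrow> nat list \<Rightarrow> nat" where
  "subtree v c = (\<lambda>w. c (v @ w))"

lemma subtree_Nil [simp]: "subtree [] c = c"
  by (simp add: subtree_def)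

lemma subtree_subtree: "subtree w (subtree v c) = subtree (v @ w) c"
  by (simp add: subtree_def)

lemma snoc_in_gw_tree_iff: "v @ [k] \<in> gw_tree c \<longleftrightarrow> v \<in> gw_tree c \<and> k < c v"
  by (auto elim: gw_tree.cases intro: gw_tree.intros)

lemma append_in_gw_tree_iff:
  "v @ w \<in> gw_tree c \<longleftrightarrow> v \<in> gw_tree c \<and> w \<in> gw_tree (subtree v c)"
proof (induction w rule: rev_induct)
  case Nil
  then show ?case by (simp add: gw_tree.root)
next
  case (snoc k w)
  have "v @ w @ [k] \<in> gw_tree c \<longleftrightarrow> v @ w \<in> gw_tree c \<and> k < c (v @ w)"
    using snoc_in_gw_tree_iff[of "v @ w" k c] by simp
  with snoc show ?case by (simp add: snoc_in_gw_tree_iff subtree_def)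
qed

lemma Cons_in_gw_tree_iff:
  "k # w \<in> gw_tree c \<longleftrightarrow> k < c [] \<and> w \<in> gw_tree (subtree [k] c)"
  using append_in_gw_tree_iff[of "[k]" w c] snoc_in_gw_tree_iff[of "[]" k c]
  by (simp add: gw_tree.root)

lemma gw_tree_unfold:
  "gw_tree c = insert [] (\<Union>k<c []. (#) k ` gw_tree (subtree [k] c))"
proof -
  have "v \<in> gw_tree c \<longleftrightarrow> v \<in> insert [] (\<Union>k<c []. (#) k ` gw_tree (subtree [k] c))" for v
    by (cases v) (auto simp: gw_tree.root Cons_in_gw_tree_iff)
  then show ?thesis by blast
qed

lemma finite_gw_tree_iff:
  "finite (gw_tree c) \<longleftrightarrow> (\<forall>k<c []. finite (gw_tree (subtree [k] c)))"
  by (subst gw_tree_unfold) (auto simp: finite_image_iff)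

lemma finite_gw_tree_subtree:
  "finite (gw_tree c) \<Longrightarrow> v \<in> gw_tree c \<Longrightarrow> finite (gw_tree (subtree v c))"
proof -
  assume "finite (gw_tree c)" "v \<in> gw_tree c"
  moreover have "(@) v ` gw_tree (subtree v c) \<subseteq> gw_tree c" 
    using \<open>v \<in> gw_tree c\<close> by (auto simp: append_in_gw_tree_iff)
  ultimately show ?thesis 
    by (meson finite_imageD finite_subset inj_onI same_append_eq)
qed

text \<open>Koenig's lemma: by \<open>finite_gw_tree_iff\<close> a node with infinite subtree has a
  child with infinite subtree, and choosing such children forever yields a ray.\<close>

lemma gromov_boundary_nonempty:
  assumes "infinite (gw_tree c)"
  shows "gromov_boundary (gw_tree c) \<noteq> {}"
proof -
  let ?P = "\<lambda>n v. v \<in> gw_tree c \<and> length v = n \<and> infinite (gw_tree (subtree v c))"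
  obtain u where u: "\<And>n. ?P n (u n)" "\<And>n. \<exists>k. u (Suc n) = u n @ [k]"
  proof (rule dependent_nat_choice[of ?P "\<lambda>_ v w. \<exists>k. w = v @ [k]", THEN exE])
    show "\<exists>v. ?P 0 v" using assms by (intro exI[of _ "[]"]) (simp add: gw_tree.root)
  next
    fix v n assume v: "?P n v"
    then obtain k where "k < subtree v c []" "infinite (gw_tree (subtree [k] (subtree v c)))"
      using finite_gw_tree_iff by blast
    with v show "\<exists>w. ?P (Suc n) w \<and> (\<exists>k. w = v @ [k])"
      by (intro exI[of _ "v @ [k]"]) (auto simp: snoc_in_gw_tree_iff subtree_subtree, simp add: subtree_def)
  qed blast
  define x where "x n = last (u (Suc n))" for n
  have "map x [0..<n] = u n" for n
  proof (induction n)
    case 0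
    then show ?case using u(1)[of 0] by simp
  next
    case (Suc n)
    then show ?case using u(2)[of n] by (auto simp: x_def)
  qed
  with u(1) have "x \<in> gromov_boundary (gw_tree c)" by (simp add: gromov_boundary_def)
  then show ?thesis by blast
qed

lemma gromov_boundary_through:
  assumes "v \<in> gw_tree c" and "infinite (gw_tree (subtree v c))"
  shows "\<exists>x\<in>gromov_boundary (gw_tree c). map x [0..<length v] = v"
proof -
  obtain y where y: "\<And>n. map y [0..<n] \<in> gw_tree (subtree v c)"
    using gromov_boundary_nonempty[OF assms(2)] by (auto simp: gromov_boundary_def)
  define x where "x i = (if i < length v then v ! i else y (i - length v))" for i
  have long: "map x [0..<length v + n] = v @ map y [0..<n]" for n
    by (rule nth_equalityI) (auto simp: x_def nth_append)
  have "map x [0..<n] \<in> gw_tree c" for n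
  proof -
    have "map x [0..<length v + n] \<in> gw_tree c"
      unfolding long using assms(1) y by (simp add: append_in_gw_tree_iff)
    moreover have "map x [0..<length v + n] = map x [0..<n] @ map x [n..<length v + n]"
      using upt_add_eq_append[of 0 n "length v"] by (simp add: add.commute)
    ultimately show ?thesis by (simp add: append_in_gw_tree_iff)
  qed
  with long[of 0] show ?thesis by (auto simp: gromov_boundary_def)
qed

text \<open>Depth 0 asks for survival and not only for presence in the tree: each of the
  \<open>N ^ K\<close> leaves is to carry a boundary point.\<close>

primrec full_to_depth :: "nat \<Rightarrow> nat \<Rightarrow> (nat list \<Rightarrow> nat) \<Rightarrow> bool" where
  "full_to_depth N 0 c \<longleftrightarrow> infinite (gw_tree c)"
| "full_to_depth N (Suc K) c \<longleftrightarrow> c [] = N \<and> (\<forall>k<N. full_to_depth N K (subtree [k] c))"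

lemma full_to_depth_leaf:
  assumes "full_to_depth N K c" "length w = K" "set w \<subseteq> {..<N}"
  shows "w \<in> gw_tree c \<and> infinite (gw_tree (subtree w c))"
  using assms
proof (induction K arbitrary: c w)
  case 0
  then show ?case by (simp add: gw_tree.root)
next
  case (Suc K)
  then obtain k w' where "w = k # w'" "length w' = K" by (metis length_Suc_conv)
  with Suc.prems Suc.IH[of "subtree [k] c" w'] show ?case
    by (auto simp: Cons_in_gw_tree_iff subtree_subtree)
qed

lemma full_to_depth_pred:
  assumes "N > 0" "full_to_depth N (Suc K) c"
  shows "full_to_depth N K c"
  using assms(2)
proof (induction K arbitrary: c)
  case 0
  then show ?case using assms(1) by (auto simp: finite_gw_tree_iff[of c])
next
  case (Suc K)
  then show ?case by (metis full_to_depth.simps(2))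
qed

lemma full_to_depth_antimono:
  assumes "N > 0" "K \<le> L" "full_to_depth N L c"
  shows "full_to_depth N K c"
  using assms(2,3) by (induction rule: inc_induct) (auto intro: full_to_depth_pred[OF assms(1)] simp del: full_to_depth.simps)

definition full_at_level :: "nat \<Rightarrow> nat \<Rightarrow> nat \<Rightarrow> (nat list \<Rightarrow> nat) \<Rightarrow> bool" where
  "full_at_level N n K c \<longleftrightarrow> (\<exists>v\<in>gw_tree c. length v = n \<and> full_to_depth N K (subtree v c))"

lemma full_at_level_0: "full_at_level N 0 K c \<longleftrightarrow> full_to_depth N K c"
  by (auto simp: full_at_level_def gw_tree.root)

text \<open>The first step of the path is split off, not the last, so that the branching property at
  the root gives a recursion in \<open>n\<close>.\<close>

lemma full_at_level_Suc:
  "full_at_level N (Suc n) K c \<longleftrightarrow> (\<exists>k<c []. full_at_level N n K (subtree [k] c))"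
proof
  assume "full_at_level N (Suc n) K c"
  then obtain k w where "k # w \<in> gw_tree c" "length w = n" "full_to_depth N K (subtree (k # w) c)"
    unfolding full_at_level_def by (metis length_Suc_conv)
  then show "\<exists>k<c []. full_at_level N n K (subtree [k] c)"
    by (auto simp: full_at_level_def Cons_in_gw_tree_iff subtree_subtree)
next
  assume "\<exists>k<c []. full_at_level N n K (subtree [k] c)"
  then obtain k w where "k # w \<in> gw_tree c" "length w = n" "full_to_depth N K (subtree (k # w) c)"
    by (auto simp: full_at_level_def Cons_in_gw_tree_iff subtree_subtree)
  then show "full_at_level N (Suc n) K c"
    unfolding full_at_level_def by (metis length_Cons)
qed

lemma full_at_level_antimono:
  assumes "N > 0" "K \<le> L" "full_at_level N n L c"
  shows "full_at_level N n K c"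
  using assms full_to_depth_antimono unfolding full_at_level_def by blast

lemma full_at_level_infinite:
  assumes "N > 0" "full_at_level N n K c"
  shows "infinite (gw_tree c)"
proof -
  have "full_at_level N n 0 c"
    using full_at_level_antimono[OF assms(1) _ assms(2)] by simp
  then show ?thesis
    using finite_gw_tree_subtree by (auto simp: full_at_level_def)
qed

section \<open>Covering numbers of the boundary\<close>

lemma covering_number_le:
  assumes "finite \<B>" "E \<subseteq> \<Union>\<B>" "card \<B> \<le> n"
    and "\<And>B. B \<in> \<B> \<Longrightarrow> \<exists>x \<rho>. B = Metric_space.mball M d x \<rho> \<and> x \<in> M \<and> 0 < \<rho> \<and> \<rho> \<le> r"
  shows "covering_number M d r E \<le> enat n"
proof -
  have "covering_number M d r E \<le> enat (card \<B>)"
    unfolding covering_number_def using assms(1,2,4) by (intro Inf_lower) blast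
  then show ?thesis using assms(3) by (meson enat_ord_simps(1) order_trans)
qed

lemma covering_number_ge:
  assumes "\<And>\<B>. finite \<B> \<Longrightarrow> E \<subseteq> \<Union>\<B> \<Longrightarrow>
      (\<And>B. B \<in> \<B> \<Longrightarrow> \<exists>x \<rho>. B = Metric_space.mball M d x \<rho> \<and> \<rho> \<le> r) \<Longrightarrow> n \<le> card \<B>"
  shows "enat n \<le> covering_number M d r E"
  unfolding covering_number_def
proof (intro Inf_greatest, clarify)
  fix \<B>
  assume "finite \<B>" "E \<subseteq> \<Union>\<B>"
    and balls: "\<B> \<subseteq> {Metric_space.mball M d x \<rho> | x \<rho>. x \<in> M \<and> 0 < \<rho> \<and> \<rho> \<le> r}"
  moreover have "\<exists>x \<rho>. B = Metric_space.mball M d x \<rho> \<and> \<rho> \<le> r" if "B \<in> \<B>" for B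
    using balls that by blast
  ultimately show "enat n \<le> enat (card \<B>)" using assms[of \<B>] by simp
qed

lemma in_mball_gromov:
  "y \<in> Metric_space.mball S gromov_dist x \<rho> \<longleftrightarrow> x \<in> S \<and> y \<in> S \<and> gromov_dist x y < \<rho>"
  by (rule Metric_space.in_mball[OF Metric_space_gromov])

lemma mball_gromov_agree:
  assumes "y \<in> Metric_space.mball S gromov_dist x \<rho>" "\<rho> \<le> 2 powr (- real n)" "i < n"
  shows "y i = x i"
  using assms gromov_dist_le_iff[of x y n] by (auto simp: in_mball_gromov)

lemma gromov_boundary_bounded:
  assumes "\<And>v. c v \<le> N" "x \<in> gromov_boundary (gw_tree c)"
  shows "x i < N"
proof -
  have "map x [0..<Suc i] \<in> gw_tree c"
    using assms(2) by (auto simp: gromov_boundary_def simp del: upt_Suc)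
  then show ?thesis using assms(1) by (auto simp: snoc_in_gw_tree_iff intro: less_le_trans)
qed

lemma card_words: "card {w. length w = n \<and> set w \<subseteq> {..<N::nat}} = N ^ n"
  using card_lists_length_eq[of "{..<N}" n] by (simp add: conj_commute)

lemma finite_words: "finite {w. length w = n \<and> set w \<subseteq> {..<N::nat}}"
  using finite_lists_length_eq[of "{..<N}" n] by (simp add: conj_commute)

text \<open>Points of a ball of radius \<open>R\<close> share their first \<open>a\<close>
  coordinates. Their coordinates from \<open>a\<close> to \<open>b - 1\<close> sort them into at
  most \<open>N ^ (b - a)\<close> classes, each inside the ball of radius \<open>r\<close> around
  any of its members.\<close>

lemma local_covering_number_le:
  assumes "\<And>v. c v \<le> N" and "R \<le> 2 powr (- real a)" "2 powr (- real b) < r" "a \<le> b"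
  shows "local_covering_number (gromov_boundary (gw_tree c)) gromov_dist R r \<le> enat (N ^ (b - a))"
  unfolding local_covering_number_def
proof (rule SUP_least)
  let ?S = "gromov_boundary (gw_tree c)" and ?ball = "Metric_space.mball (gromov_boundary (gw_tree c)) gromov_dist"
  fix x assume "x \<in> ?S"
  define E where "E = ?ball x R"
  define g where "g y = map y [a..<b]" for y :: "nat \<Rightarrow> nat"
  let ?W = "{w. length w = b - a \<and> set w \<subseteq> {..<N}}"
  have gW: "g ` E \<subseteq> ?W"
    using gromov_boundary_bounded[of c N] assms(1)
    by (auto simp: g_def E_def in_mball_gromov)
  then have fin: "finite (g ` E)" using finite_words finite_subset by blast
  have "card (g ` E) \<le> N ^ (b - a)" using card_mono[OF finite_words gW] by (simp add: card_words)
  \<comment> \<open>Balls must be centred in the boundary, so each word that occurs is represented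
    by a point of \<open>E\<close>.\<close>
  then have card: "card ((\<lambda>w. ?ball (inv_into E g w) r) ` g ` E) \<le> N ^ (b - a)"
    using card_image_le[OF fin] order_trans by blast
  have "y \<in> ?ball (inv_into E g (g y)) r" if y: "y \<in> E" for y
  proof -
    define z where "z = inv_into E g (g y)"
    have "g y \<in> g ` E" using y by blast
    then have z: "z \<in> E" "g z = g y"
      unfolding z_def by (rule inv_into_into, rule f_inv_into_f)
    have "z i = y i" if "i < b" for i
    proof (cases "i < a")
      case True
      then show ?thesis using mball_gromov_agree[OF _ assms(2)] y z(1) unfolding E_def by metis
    next
      case False
      then have "g z ! (i - a) = z i" "g y ! (i - a) = y i" using that by (auto simp: g_def)
      with z(2) show ?thesis by simp
    qed
    then have "gromov_dist z y < r"
      using gromov_dist_le_iff[of z y b] assms(3) by auto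
    with y z(1) show ?thesis unfolding z_def[symmetric] by (auto simp: E_def in_mball_gromov)
  qed
  then have cover: "E \<subseteq> \<Union>((\<lambda>w. ?ball (inv_into E g w) r) ` g ` E)" by blast
  have "0 < r" using assms(3) by (smt (verit) powr_ge_zero)
  have "covering_number ?S gromov_dist r E \<le> enat (N ^ (b - a))"
  proof (rule covering_number_le[OF _ cover card])
    fix B assume "B \<in> (\<lambda>w. ?ball (inv_into E g w) r) ` g ` E"
    then obtain y where y: "y \<in> E" "B = ?ball (inv_into E g (g y)) r" by blast
    then have "inv_into E g (g y) \<in> ?S"
      using inv_into_into[of "g y" g E] by (auto simp: E_def in_mball_gromov)
    with y \<open>0 < r\<close> show "\<exists>x \<rho>. B = ?ball x \<rho> \<and> x \<in> ?S \<and> 0 < \<rho> \<and> \<rho> \<le> r" by blast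
  qed (use fin in simp)
  then show "covering_number ?S gromov_dist r (?ball x R) \<le> enat (N ^ (b - a))"
    by (simp add: E_def)
qed

text \<open>Every leaf of the full subtree extends to a boundary point near \<open>x\<close>. Points
  in a common ball of radius at most \<open>r\<close> agree up to level \<open>n + K\<close>, so
  different leaves need different balls.\<close>

lemma local_covering_number_ge:
  assumes "N > 0" "full_at_level N n K c"
    and "2 powr (- real n) < R" "r \<le> 2 powr (- real (n + K))"
  shows "enat (N ^ K) \<le> local_covering_number (gromov_boundary (gw_tree c)) gromov_dist R r"
proof -
  let ?S = "gromov_boundary (gw_tree c)" and ?ball = "Metric_space.mball (gromov_boundary (gw_tree c)) gromov_dist"
  let ?W = "{w. length w = K \<and> set w \<subseteq> {..<N}}"
  obtain v where v: "v \<in> gw_tree c" "length v = n" "full_to_depth N K (subtree v c)"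
    using assms(2) by (auto simp: full_at_level_def)
  have "infinite (gw_tree (subtree v c))"
    using full_to_depth_antimono[OF assms(1) _ v(3), of 0] by simp
  then obtain x where x: "x \<in> ?S" "map x [0..<n] = v"
    using gromov_boundary_through v by blast
  have "\<exists>p\<in>?S. map p [0..<n + K] = v @ w" if "w \<in> ?W" for w
  proof -
    have "w \<in> gw_tree (subtree v c)" "infinite (gw_tree (subtree (v @ w) c))"
      using full_to_depth_leaf[OF v(3), of w] that by (auto simp: subtree_subtree)
    with gromov_boundary_through[of "v @ w" c] v(1,2) that show ?thesis
      by (simp add: append_in_gw_tree_iff)
  qed
  then have "\<forall>w\<in>?W. \<exists>p. p \<in> ?S \<and> map p [0..<n + K] = v @ w" by blast
  then obtain p where p: "\<And>w. w \<in> ?W \<Longrightarrow> p w \<in> ?S" "\<And>w. w \<in> ?W \<Longrightarrow> map (p w) [0..<n + K] = v @ w"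
    by (elim bchoice[THEN exE]) blast
  have p_ball: "p w \<in> ?ball x R" if "w \<in> ?W" for w
  proof -
    have "x i = p w i" if "i < n" for i
    proof -
      have "x i = map x [0..<n] ! i" using that by simp
      also have "\<dots> = (v @ w) ! i" using x(2) v(2) that by (simp add: nth_append)
      also have "\<dots> = map (p w) [0..<n + K] ! i" by (simp only: p(2)[OF \<open>w \<in> ?W\<close>])
      also have "\<dots> = p w i" using that by simp
      finally show ?thesis .
    qed
    then have "gromov_dist x (p w) < R"
      using gromov_dist_le_iff[of x "p w" n] assms(3) by auto
    with x(1) p(1) that show ?thesis by (auto simp: in_mball_gromov)
  qed
  have "enat (N ^ K) \<le> covering_number ?S gromov_dist r (?ball x R)"
  proof (rule covering_number_ge)
    fix \<B> assume fin: "finite \<B>" and cover: "?ball x R \<subseteq> \<Union>\<B>"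
      and balls: "\<And>B. B \<in> \<B> \<Longrightarrow> \<exists>x \<rho>. B = ?ball x \<rho> \<and> \<rho> \<le> r"
    have "\<forall>w\<in>?W. \<exists>B. B \<in> \<B> \<and> p w \<in> B"
      using p_ball cover by blast
    then obtain \<beta> where \<beta>: "\<And>w. w \<in> ?W \<Longrightarrow> \<beta> w \<in> \<B>" "\<And>w. w \<in> ?W \<Longrightarrow> p w \<in> \<beta> w"
      by (elim bchoice[THEN exE]) blast
    have "inj_on \<beta> ?W"
    proof (rule inj_onI)
      fix w w' assume w: "w \<in> ?W" "w' \<in> ?W" "\<beta> w = \<beta> w'"
      obtain z \<rho> where z: "\<beta> w = ?ball z \<rho>" "\<rho> \<le> 2 powr (- real (n + K))"
        using balls[OF \<beta>(1)[OF w(1)]] assms(4) order_trans by blast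
      have agree: "p u i = z i" if "u \<in> ?W" "\<beta> u = \<beta> w" "i < n + K" for u i
        using mball_gromov_agree[OF _ z(2) that(3)] \<beta>(2)[OF that(1)] unfolding that(2) z(1) by simp
      have "map (p w) [0..<n + K] = map (p w') [0..<n + K]"
        using agree[OF w(1)] agree[OF w(2)] w(3) by simp
      then have "v @ w = v @ w'" unfolding p(2)[OF w(1)] p(2)[OF w(2)] .
      then show "w = w'" by simp
    qed
    then show "N ^ K \<le> card \<B>"
      using card_inj_on_le[of \<beta> ?W \<B>] \<beta>(1) fin unfolding card_words by blast
  qed
  also have "\<dots> \<le> local_covering_number ?S gromov_dist R r"
    unfolding local_covering_number_def using x(1) by (rule SUP_upper)
  finally show ?thesis .
qed

section \<open>Dimension bounds for the boundary\<close>

lemma assouad_dim_gromov_le: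
  assumes "N > 0" "\<And>v. c v \<le> N"
  shows "assouad_dim (gromov_boundary (gw_tree c)) gromov_dist \<le> ereal (log 2 N)"
proof -
  let ?S = "gromov_boundary (gw_tree c)"
  have "ereal_of_enat (local_covering_number ?S gromov_dist R r)
      \<le> ereal (real N ^ 2 * (R / r) powr log 2 N)" if Rr: "0 < r" "r \<le> R" "R < 1" for R r
  proof -
    \<comment> \<open>The exponents are rounded outwards, and the \<open>+ 1\<close> in
      \<open>b\<close> keeps \<open>2 powr (- real b)\<close> strictly below \<open>r\<close>. This
      costs at most two extra levels, whence the constant \<open>N ^ 2\<close>.\<close>
    define a where "a = nat \<lfloor>- log 2 R\<rfloor>"
    define b where "b = nat (\<lfloor>- log 2 r\<rfloor> + 1)"
    have R0: "0 < R" "log 2 R < 0" and le: "log 2 r \<le> log 2 R"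
      using Rr by auto
    have a: "real a \<le> - log 2 R" "- log 2 R < real a + 1"
      unfolding a_def using R0(2) by linarith+
    have b: "real b \<le> - log 2 r + 1" "- log 2 r < real b"
      unfolding b_def using R0(2) le by linarith+
    have ab: "a \<le> b" using a b le by linarith
    have "R = 2 powr (log 2 R)" using R0 by simp
    also have "\<dots> \<le> 2 powr (- real a)" using a by (subst powr_le_cancel_iff) auto
    finally have 1: "R \<le> 2 powr (- real a)" .
    have "2 powr (- real b) < 2 powr (log 2 r)" using b by (subst powr_less_cancel_iff) auto
    also have "\<dots> = r" using Rr by simp
    finally have 2: "2 powr (- real b) < r" .
    have "ereal_of_enat (local_covering_number ?S gromov_dist R r) \<le> ereal (real (N ^ (b - a)))"
      using local_covering_number_le[OF assms(2) 1 2 ab]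
      unfolding ereal_of_enat_simps(1)[symmetric] ereal_of_enat_le_iff .
    also have "real (N ^ (b - a)) = real N powr real (b - a)"
      using assms(1) by (simp add: powr_realpow)
    also have "\<dots> \<le> real N powr (2 + log 2 (R / r))"
    proof (rule powr_mono)
      show "real (b - a) \<le> 2 + log 2 (R / r)"
        using a(2) b(1) ab Rr(1) R0(1) by (simp add: log_divide of_nat_diff)
    qed (use assms(1) in simp)
    also have "\<dots> = real N ^ 2 * (R / r) powr log 2 N"
    proof -
      have "real N powr log 2 (R / r) = (R / r) powr log 2 N"
        using assms(1) Rr R0 by (simp add: powr_def log_def)
      then show ?thesis using assms(1) by (simp add: powr_add)
    qed
    finally show ?thesis by simp
  qed
  then show ?thesis
    unfolding assouad_dim_def using assms(1)
    by (intro Inf_lower) (auto intro!: exI[of _ "real N ^ 2"])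
qed

text \<open>Positivity of \<open>\<phi>\<close> makes \<open>R powr (1 + \<phi> R)\<close> at most
  \<open>R\<close>, so the pairs of scales tested here are among those tested by the Assouad
  dimension.\<close>

lemma assouad_dim_at_le_assouad_dim:
  assumes "\<And>x. 0 < x \<Longrightarrow> x < 1 \<Longrightarrow> 0 < \<phi> x"
  shows "assouad_dim_at \<phi> M d \<le> assouad_dim M d"
  unfolding assouad_dim_at_def assouad_dim_def
proof (rule Inf_superset_mono, clarify)
  fix s C' :: real
  assume C': "0 < C'" and bound: "\<forall>R r. 0 < r \<and> r \<le> R \<and> R < 1 \<longrightarrow>
      ereal_of_enat (local_covering_number M d R r) \<le> ereal (C' * (R / r) powr s)"
  have "R powr (1 + \<phi> R) \<le> R" if "0 < R" "R < 1" for R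
    using powr_mono'[of 1 "1 + \<phi> R" R] assms[of R] that by simp
  with C' bound show "\<exists>s'. ereal s = ereal s' \<and> (\<exists>C'>0. \<forall>R. 0 < R \<and> R < 1 \<longrightarrow>
      (let r = R powr (1 + \<phi> R) in
       ereal_of_enat (local_covering_number M d R r) \<le> ereal (C' * (R / r) powr s')))"
    by (intro exI[of _ s] conjI exI[of _ C']) (auto simp: Let_def)
qed

text \<open>On the scales chosen below, \<open>R / r\<close> is \<open>2 powr t n\<close>. The bound
  on \<open>\<phi>\<close> keeps \<open>t n\<close> within the depth of the available full subtrees,
  which then force about \<open>N powr t n\<close> balls; as \<open>t n\<close> tends to infinity,
  no exponent \<open>s\<close> below \<open>log 2 N\<close> survives.\<close>

lemma assouad_dim_at_gromov_ge:
  assumes N: "N \<ge> 2"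
    and full: "\<exists>\<^sub>F n in sequentially. full_at_level N n (nat \<lfloor>C / ln 2 * ln (real n)\<rfloor>) c"
    and C: "C > 0"
    and lim: "filterlim (\<lambda>x. \<phi> x * \<bar>ln x\<bar>) at_top (at_right 0)"
    and bound: "eventually (\<lambda>x. \<phi> x \<le> C * (ln \<bar>ln x\<bar> / \<bar>ln x\<bar>)) (at_right 0)"
  shows "ereal (log 2 N) \<le> assouad_dim_at \<phi> (gromov_boundary (gw_tree c)) gromov_dist"
  unfolding assouad_dim_at_def
proof (rule Inf_greatest, clarify)
  let ?S = "gromov_boundary (gw_tree c)"
  fix s C' :: real
  assume C': "0 < C'" and adm: "\<forall>R. 0 < R \<and> R < 1 \<longrightarrow>
      (let r = R powr (1 + \<phi> R) in
       ereal_of_enat (local_covering_number ?S gromov_dist R r) \<le> ereal (C' * (R / r) powr s))"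
  define D where "D = log 2 N"
  have N_D: "real N = 2 powr D" using N by (simp add: D_def)
  \<comment> \<open>The shift by 1 puts \<open>R n\<close> strictly above
    \<open>2 powr (- real n)\<close>, as the lower covering bound requires.\<close>
  define R where "R n = 2 powr (1 - real n)" for n
  define t where "t n = \<phi> (R n) * (real n - 1)" for n
  have Rlim: "filterlim R (at_right 0) sequentially" unfolding R_def by real_asymp
  have "filterlim (\<lambda>n. \<phi> (R n) * \<bar>ln (R n)\<bar> / ln 2) at_top sequentially"
    using filterlim_tendsto_pos_mult_at_top[OF tendsto_const, of "1 / ln 2" "\<lambda>n. \<phi> (R n) * \<bar>ln (R n)\<bar>" sequentially]
      filterlim_compose[OF lim Rlim] by simp
  then have "filterlim t at_top sequentially"
    by (rule filterlim_mono_eventually)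
       (auto intro!: eventually_sequentiallyI[of 1] simp: R_def t_def ln_powr abs_mult)
  then have t1: "eventually (\<lambda>n. 1 \<le> t n) sequentially"
    and t2: "D > s \<Longrightarrow> eventually (\<lambda>n. log 2 (2 powr (2 * D) * C') / (D - s) < t n) sequentially"
    by (simp_all add: filterlim_at_top filterlim_at_top_dense) (simp add: filterlim_at_top_dense flip: filterlim_at_top)
  have bd: "eventually (\<lambda>n. \<phi> (R n) \<le> C * (ln \<bar>ln (R n)\<bar> / \<bar>ln (R n)\<bar>)) sequentially"
    by (rule eventually_compose_filterlim[OF bound Rlim])
  show "ereal (log 2 N) \<le> ereal s"
  proof (rule ccontr)
    assume "\<not> ?thesis"
    then have Ds: "D > s" by (simp add: D_def)
    have "\<exists>\<^sub>F n in sequentially. full_at_level N n (nat \<lfloor>C / ln 2 * ln (real n)\<rfloor>) c \<and>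
        (1 \<le> t n \<and> log 2 (2 powr (2 * D) * C') / (D - s) < t n \<and>
        \<phi> (R n) \<le> C * (ln \<bar>ln (R n)\<bar> / \<bar>ln (R n)\<bar>) \<and> n \<ge> 2)"
      using full t1 t2[OF Ds] bd eventually_ge_at_top[of 2]
      by (intro frequently_eventually_frequently eventually_conj)
    then obtain n where n: "full_at_level N n (nat \<lfloor>C / ln 2 * ln (real n)\<rfloor>) c" "1 \<le> t n"
        "log 2 (2 powr (2 * D) * C') / (D - s) < t n"
        "\<phi> (R n) \<le> C * (ln \<bar>ln (R n)\<bar> / \<bar>ln (R n)\<bar>)" "n \<ge> 2"
      by (auto dest!: frequently_ex)
    have lnR: "\<bar>ln (R n)\<bar> = (real n - 1) * ln 2" using n(5) by (simp add: R_def ln_powr abs_mult)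
    have R01: "0 < R n" "R n < 1" using n(5) powr_less_mono[of "1 - real n" 0 2] by (auto simp: R_def)
    have "t n * ln 2 = \<phi> (R n) * \<bar>ln (R n)\<bar>" by (simp add: lnR t_def)
    also have "\<dots> \<le> C * (ln \<bar>ln (R n)\<bar> / \<bar>ln (R n)\<bar>) * \<bar>ln (R n)\<bar>"
      using n(4) by (rule mult_right_mono) simp
    also have "\<dots> = C * ln ((real n - 1) * ln 2)" using n(5) by (simp add: lnR)
    also have "\<dots> \<le> C * ln (real n)"
    proof -
      have "(real n - 1) * ln 2 \<le> real n * 1" using ln_2_less_1 n(5) by (intro mult_mono) auto
      then show ?thesis using C n(5) by simp
    qed
    finally have tC: "t n \<le> C / ln 2 * ln (real n)" by (simp add: field_simps)
    \<comment> \<open>With \<open>r = 2 powr (1 - real n - t n)\<close>, the condition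
      \<open>r \<le> 2 powr (- real (n + K))\<close> reads \<open>K \<le> t n - 1\<close>. The loss
      against \<open>t n\<close> stays at most 2.\<close>
    define K where "K = nat \<lfloor>t n\<rfloor> - 1"
    have K: "real K \<le> t n - 1" "t n - 2 \<le> real K" using n(2) unfolding K_def by linarith+
    have "K \<le> nat \<lfloor>C / ln 2 * ln (real n)\<rfloor>" using tC unfolding K_def by linarith
    then have fullK: "full_at_level N n K c" using full_at_level_antimono[of N] n(1) N by simp
    have r: "R n powr (1 + \<phi> (R n)) = 2 powr (1 - real n - t n)"
      by (simp add: R_def powr_powr t_def algebra_simps)
    have "enat (N ^ K) \<le> local_covering_number ?S gromov_dist (R n) (R n powr (1 + \<phi> (R n)))"
      using fullK N K(1) by (intro local_covering_number_ge) (auto simp: r, simp add: R_def)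
    then have "ereal (real (N ^ K)) \<le> ereal_of_enat (local_covering_number ?S gromov_dist (R n) (R n powr (1 + \<phi> (R n))))"
      unfolding ereal_of_enat_simps(1)[symmetric] ereal_of_enat_le_iff .
    also have "\<dots> \<le> ereal (C' * (R n / R n powr (1 + \<phi> (R n))) powr s)"
      using adm R01 by (auto simp: Let_def)
    also have "R n / R n powr (1 + \<phi> (R n)) = 2 powr t n"
      unfolding r by (simp add: R_def flip: powr_diff)
    finally have "real (N ^ K) \<le> C' * 2 powr (t n * s)" by (simp add: powr_powr)
    moreover have "2 powr (D * (t n - 2)) \<le> real (N ^ K)"
    proof -
      have "2 powr (D * (t n - 2)) = real N powr (t n - 2)" by (simp add: N_D powr_powr)
      also have "\<dots> \<le> real N powr real K" using K N by (intro powr_mono) auto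
      finally show ?thesis using N by (simp add: powr_realpow)
    qed
    ultimately have "2 powr (D * (t n - 2)) \<le> C' * 2 powr (t n * s)" by linarith
    then have "2 powr (D * (t n - 2)) * 2 powr (2 * D - t n * s)
        \<le> C' * 2 powr (t n * s) * 2 powr (2 * D - t n * s)"
      by (rule mult_right_mono) simp
    then have "2 powr ((D - s) * t n) \<le> 2 powr (2 * D) * C'"
      by (simp add: mult.assoc algebra_simps flip: powr_add)
    then have "(D - s) * t n \<le> log 2 (2 powr (2 * D) * C')"
      using C' by (subst le_log_iff) auto
    with n(3) Ds show False by (simp add: field_simps)
  qed
qed

section \<open>Generating functions\<close>

definition pgf :: "nat pmf \<Rightarrow> real \<Rightarrow> real" where
  "pgf p x = (\<Sum>k\<in>set_pmf p. pmf p k * x ^ k)"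

text \<open>The slope of the chord of \<open>pgf p\<close> between \<open>x\<close> and 1, written
  without division so that it also makes sense at 1, where it is the mean offspring number.\<close>

definition pgf_slope :: "nat pmf \<Rightarrow> real \<Rightarrow> real" where
  "pgf_slope p x = (\<Sum>k\<in>set_pmf p. pmf p k * (\<Sum>i<k. x ^ i))"

lemma pgf_eq_slope:
  assumes "finite (set_pmf p)"
  shows "1 - pgf p x = (1 - x) * pgf_slope p x"
proof -
  have "1 - pgf p x = (\<Sum>k\<in>set_pmf p. pmf p k * (1 - x ^ k))"
    using sum_pmf_eq_1[OF assms order_refl] by (simp add: pgf_def algebra_simps sum_subtractf)
  also have "\<dots> = (\<Sum>k\<in>set_pmf p. (1 - x) * (pmf p k * (\<Sum>i<k. x ^ i)))"
    by (intro sum.cong) (simp_all add: one_diff_power_eq)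
  finally show ?thesis by (simp add: pgf_slope_def sum_distrib_left)
qed

lemma pgf_mono: "0 \<le> x \<Longrightarrow> x \<le> y \<Longrightarrow> pgf p x \<le> pgf p y"
  unfolding pgf_def by (intro sum_mono mult_left_mono power_mono) auto

text \<open>Strict convexity of \<open>pgf p\<close>, seen through chords ending at 1: the term with
  \<open>k = N\<close> and \<open>i = 1\<close> already grows strictly.\<close>

lemma pgf_slope_strict_mono:
  assumes "finite (set_pmf p)" "N \<in> set_pmf p" "N \<ge> 2" "0 \<le> x" "x < y"
  shows "pgf_slope p x < pgf_slope p y"
  unfolding pgf_slope_def
proof (rule sum_strict_mono_ex1[OF assms(1)])
  show "\<forall>k\<in>set_pmf p. pmf p k * (\<Sum>i<k. x ^ i) \<le> pmf p k * (\<Sum>i<k. y ^ i)"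
    using assms(4,5) by (intro ballI mult_left_mono sum_mono power_mono) auto
  have "(\<Sum>i<N. x ^ i) < (\<Sum>i<N. y ^ i)"
  proof (rule sum_strict_mono_ex1)
    show "\<forall>i\<in>{..<N}. x ^ i \<le> y ^ i" using assms(4,5) by (intro ballI power_mono) auto
    show "\<exists>i\<in>{..<N}. x ^ i < y ^ i" using assms(3,5) by (intro bexI[of _ 1]) auto
  qed simp
  then have "pmf p N * (\<Sum>i<N. x ^ i) < pmf p N * (\<Sum>i<N. y ^ i)"
    using assms(2) by (intro mult_strict_left_mono) (auto simp: pmf_positive)
  with assms(2) show "\<exists>k\<in>set_pmf p. pmf p k * (\<Sum>i<k. x ^ i) < pmf p k * (\<Sum>i<k. y ^ i)" by blast
qed

text \<open>The chord from \<open>e\<close> to 1 has slope 1. By strict convexity the chord from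
  \<open>y\<close> to 1 is steeper, which puts the graph below the diagonal at
  \<open>y\<close>.\<close>

lemma pgf_less_above_fixed_point:
  assumes "finite (set_pmf p)" "N \<in> set_pmf p" "N \<ge> 2"
    and "pgf p e = e" "0 \<le> e" "e < y" "y < 1"
  shows "pgf p y < y"
proof -
  have "(1 - e) * pgf_slope p e = (1 - e) * 1" using pgf_eq_slope[OF assms(1), of e] assms(4) by simp
  then have "pgf_slope p e = 1" using assms(6,7) by simp
  then have "1 < pgf_slope p y"
    using pgf_slope_strict_mono[OF assms(1-3,5,6)] by simp
  then have "(1 - y) * 1 < (1 - y) * pgf_slope p y" using assms(7) by (intro mult_strict_left_mono) auto
  then show ?thesis using pgf_eq_slope[OF assms(1), of y] by simp
qed

lemma expectation_eq_pgf_slope: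
  assumes "finite (set_pmf p)"
  shows "measure_pmf.expectation p real = pgf_slope p 1"
  using integral_measure_pmf_real[OF assms, of p real]
  by (simp add: pgf_slope_def mult.commute)

text \<open>The distance \<open>x\<close> from 1 is multiplied by
  \<open>pgf_slope p (1 - x)\<close>, which is continuous and equals the mean at
  \<open>x = 0\<close>. Near 0 it exceeds any \<open>\<mu>\<close> below the mean; the midpoint
  between 1 and the mean is taken.\<close>

lemma pgf_expanding_at_1:
  assumes "finite (set_pmf p)" "measure_pmf.expectation p real > 1"
  obtains \<mu> \<delta> where "\<mu> > 1" "0 < \<delta>" "\<delta> \<le> 1"
    "\<And>x. 0 \<le> x \<Longrightarrow> x \<le> \<delta> \<Longrightarrow> \<mu> * x \<le> 1 - pgf p (1 - x)"
proof -
  define \<mu> where "\<mu> = (1 + pgf_slope p 1) / 2"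
  have \<mu>: "1 < \<mu>" "\<mu> < pgf_slope p 1"
    using assms by (auto simp: \<mu>_def expectation_eq_pgf_slope)
  have "continuous (at 0) (\<lambda>x. pgf_slope p (1 - x))"
    unfolding pgf_slope_def by (intro continuous_intros)
  then have "((\<lambda>x. pgf_slope p (1 - x)) \<longlongrightarrow> pgf_slope p 1) (at 0)" by (simp add: continuous_at)
  then have "eventually (\<lambda>x. \<mu> < pgf_slope p (1 - x)) (at 0)"
    using \<mu>(2) by (rule order_tendstoD)
  then obtain d where d: "d > 0" "\<And>x. x \<noteq> 0 \<Longrightarrow> \<bar>x\<bar> < d \<Longrightarrow> \<mu> < pgf_slope p (1 - x)"
    by (auto simp: eventually_at dist_real_def)
  show thesis
  proof (rule that[of \<mu> "min 1 (d / 2)"])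
    fix x assume x: "0 \<le> x" "x \<le> min 1 (d / 2)"
    show "\<mu> * x \<le> 1 - pgf p (1 - x)"
    proof (cases "x = 0")
      case True
      then show ?thesis using pgf_eq_slope[OF assms(1), of 1] by simp
    next
      case False
      then have "\<mu> \<le> pgf_slope p (1 - x)" using d x by (intro less_imp_le) auto
      then have "x * \<mu> \<le> x * pgf_slope p (1 - x)" using x(1) by (rule mult_left_mono)
      then show ?thesis using pgf_eq_slope[OF assms(1), of "1 - x"] by (simp add: mult.commute)
    qed
  qed (use \<mu> d in auto)
qed

section \<open>The branching property\<close>

text \<open>All words receive independent offspring numbers, also those outside the tree; the random
  tree is then the deterministic function \<open>gw_tree\<close> of this family.\<close>

definition gw_measure :: "nat pmf \<Rightarrow> (nat list \<Rightarrow> nat) measure" where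
  "gw_measure p = PiM UNIV (\<lambda>_. measure_pmf p)"

lemma space_gw_measure [simp]: "space (gw_measure p) = UNIV"
  by (simp add: gw_measure_def space_PiM PiE_def)

lemma sets_gw_measure [measurable_cong]:
  "sets (gw_measure p) = sets (PiM UNIV (\<lambda>_. count_space UNIV))"
  unfolding gw_measure_def by (intro sets_PiM_cong) auto

lemma prob_space_gw_measure: "prob_space (gw_measure p)"
  unfolding gw_measure_def by (intro prob_space_PiM measure_pmf.prob_space_axioms)

lemma measurable_offspring [measurable]:
  "(\<lambda>c. c v) \<in> measurable (gw_measure p) (count_space UNIV)"
  by measurable

lemma measurable_reindex:
  "(\<lambda>c w. c (h w)) \<in> measurable (gw_measure p) (gw_measure p)"
  unfolding gw_measure_def
  by (rule measurable_PiM_single') (auto intro: measurable_component_singleton)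

lemma measurable_subtree [measurable]:
  "subtree v \<in> measurable (gw_measure p) (gw_measure p)"
  unfolding subtree_def by (rule measurable_reindex)

lemma measurable_in_gw_tree [measurable]:
  "Measurable.pred (gw_measure p) (\<lambda>c. v \<in> gw_tree c)"
proof (induction v rule: rev_induct)
  case Nil
  then show ?case by (simp add: gw_tree.root)
next
  case (snoc k v)
  note [measurable] = snoc
  show ?case unfolding snoc_in_gw_tree_iff by measurable
qed

text \<open>There are only countably many lists of nodes, so finiteness becomes a countable
  combination of membership events.\<close>

lemma finite_iff_subset_set: "finite A \<longleftrightarrow> (\<exists>xs. \<forall>v. v \<in> A \<longrightarrow> v \<in> set xs)"
  using finite_list[of A] by (auto intro: finite_subset[OF _ List.finite_set])

lemma measurable_finite_gw_tree [measurable]: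
  "Measurable.pred (gw_measure p) (\<lambda>c. finite (gw_tree c))"
  unfolding finite_iff_subset_set by measurable

lemma measurable_full_to_depth [measurable]:
  "Measurable.pred (gw_measure p) (full_to_depth N K)"
proof (induction K)
  case 0
  then show ?case by simp
next
  case (Suc K)
  note [measurable] = Suc
  show ?case unfolding full_to_depth.simps by measurable
qed

lemma measurable_full_at_level [measurable]:
  "Measurable.pred (gw_measure p) (full_at_level N n K)"
  unfolding full_at_level_def Bex_def by measurable

section \<open>Independence of the root and the child subtrees\<close>

lemma indep_vars_offspring:
  "prob_space.indep_vars (gw_measure p) (\<lambda>_. measure_pmf p) (\<lambda>v c. c v) UNIV"
proof -
  interpret prob_space "gw_measure p" by (rule prob_space_gw_measure)
  have comp: "distr (gw_measure p) (measure_pmf p) (\<lambda>c. c v) = measure_pmf p" for v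
    unfolding gw_measure_def
    by (rule distr_PiM_component) (auto intro: measure_pmf.prob_space_axioms)
  have "distr (gw_measure p) (gw_measure p) (\<lambda>c. c) = gw_measure p"
    by (rule distr_id2) simp
  then show ?thesis
    by (subst indep_vars_iff_distr_eq_PiM') (simp_all add: comp restrict_UNIV flip: gw_measure_def)
qed

text \<open>Distinct coordinates of an independent, identically distributed family again form such a
  family. With \<open>h = (#) k\<close>, a child subtree gets the law of the whole tree.\<close>

lemma distr_gw_measure_reindex:
  assumes "inj h"
  shows "distr (gw_measure p) (gw_measure p) (\<lambda>c w. c (h w)) = gw_measure p"
  using distr_PiM_reindex[of UNIV "\<lambda>_. measure_pmf p" h UNIV] assms
  by (simp add: gw_measure_def measure_pmf.prob_space_axioms restrict_UNIV)

text \<open>Index \<open>0\<close> stands for the root, index \<open>Suc k\<close> for the subtree of its child \<open>k\<close>.\<close>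

definition root_or_child :: "nat \<Rightarrow> nat list \<Rightarrow> nat list" where
  "root_or_child i w = (case i of 0 \<Rightarrow> [] | Suc k \<Rightarrow> k # w)"

text \<open>The root alone and, for each \<open>k\<close>, the words starting with \<open>k\<close>
  form disjoint blocks of coordinates, and functions of disjoint blocks are independent.\<close>

lemma indep_vars_root_subtrees:
  "prob_space.indep_vars (gw_measure p) (\<lambda>_. gw_measure p) (\<lambda>i c w. c (root_or_child i w)) UNIV"
proof -
  interpret prob_space "gw_measure p" by (rule prob_space_gw_measure)
  let ?K = "\<lambda>i. range (root_or_child i)"
  have "disjoint_family ?K"
    by (auto simp: disjoint_family_on_def root_or_child_def split: nat.splits)
  then have "indep_vars (\<lambda>i. PiM (?K i) (\<lambda>_. measure_pmf p)) (\<lambda>i c. restrict c (?K i)) UNIV"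
    using indep_vars_restrict[OF indep_vars_offspring, where K = ?K and L = UNIV] by simp
  then have "indep_vars (\<lambda>_. gw_measure p)
      (\<lambda>i c. (\<lambda>f w. f (root_or_child i w)) (restrict c (?K i))) UNIV"
    by (rule indep_vars_compose2) (auto simp: gw_measure_def intro!: measurable_PiM_single' measurable_component_singleton)
  then show ?thesis by simp
qed

lemma measure_gw_branching:
  assumes S: "S \<in> sets (gw_measure p)"
  shows "measure (gw_measure p) {c. c [] = j \<and> (\<forall>k<j. subtree [k] c \<in> S)}
    = pmf p j * measure (gw_measure p) S ^ j"
proof -
  interpret prob_space "gw_measure p" by (rule prob_space_gw_measure)
  let ?Y = "\<lambda>i c w. c (root_or_child i w)"
  \<comment> \<open>The component with index 0 is the constant function with value
    \<open>c []\<close>, so it lies in \<open>A 0\<close> exactly when the root has \<open>j\<close>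
    children.\<close>
  define A where "A i = (case i of 0 \<Rightarrow> {c. c [] = j} | Suc _ \<Rightarrow> S)" for i :: nat
  have root [measurable]: "{c. c [] = j} \<in> sets (gw_measure p)"
  proof -
    have "Measurable.pred (gw_measure p) (\<lambda>c. c [] = j)" by measurable
    then show ?thesis by (simp add: pred_def)
  qed
  have "prob (\<Inter>i\<in>{..<Suc j}. ?Y i -` A i \<inter> space (gw_measure p))
      = (\<Prod>i\<in>{..<Suc j}. prob (?Y i -` A i \<inter> space (gw_measure p)))"
    by (rule indep_varsD[OF indep_vars_root_subtrees]) (auto simp: A_def S root split: nat.splits)
  also have "(\<Inter>i\<in>{..<Suc j}. ?Y i -` A i \<inter> space (gw_measure p))
      = {c. c [] = j \<and> (\<forall>k<j. subtree [k] c \<in> S)}"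
    unfolding lessThan_Suc_eq_insert_0
    by (auto simp: A_def root_or_child_def subtree_def)
  also have "(\<Prod>i\<in>{..<Suc j}. prob (?Y i -` A i \<inter> space (gw_measure p)))
      = prob {c. c [] = j} * (\<Prod>k<j. prob S)"
  proof -
    have "prob (?Y (Suc k) -` S) = prob S" for k
    proof -
      have "prob S = measure (distr (gw_measure p) (gw_measure p) (?Y (Suc k))) S"
        by (subst distr_gw_measure_reindex) (auto simp: inj_def root_or_child_def)
      also have "\<dots> = prob (?Y (Suc k) -` S)"
        using S by (subst measure_distr) (auto intro: measurable_reindex)
      finally show ?thesis ..
    qed
    moreover have "?Y 0 -` {c. c [] = j} = {c. c [] = j}" by (auto simp: root_or_child_def)
    ultimately show ?thesis by (simp add: prod.lessThan_Suc_shift A_def del: prod.lessThan_Suc)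
  qed
  also have "prob {c. c [] = j} = pmf p j"
  proof -
    have "pmf p j = measure (distr (gw_measure p) (measure_pmf p) (\<lambda>c. c [])) {j}"
      unfolding gw_measure_def
      by (subst distr_PiM_component) (auto intro: measure_pmf.prob_space_axioms simp: measure_pmf_single)
    also have "\<dots> = prob {c. c [] = j}"
      by (subst measure_distr) (auto simp: vimage_def)
    finally show ?thesis ..
  qed
  finally show ?thesis by simp
qed

lemma AE_gw_offspring: "AE c in gw_measure p. \<forall>v. c v \<in> set_pmf p"
proof -
  have "AE c in gw_measure p. c v \<in> set_pmf p" for v
  proof -
    have "AE k in distr (gw_measure p) (measure_pmf p) (\<lambda>c. c v). k \<in> set_pmf p"
      unfolding gw_measure_def
      by (subst distr_PiM_component) (auto intro: measure_pmf.prob_space_axioms AE_measure_pmf)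
    then show ?thesis by (subst (asm) AE_distr_iff) auto
  qed
  then show ?thesis by (simp add: AE_all_countable)
qed

text \<open>Summing the branching property over the number of children of the root produces the
  generating function. All recursions for failure events rest on this.\<close>

lemma measure_gw_all_children:
  assumes fin: "finite (set_pmf p)" and S: "S \<in> sets (gw_measure p)"
  shows "measure (gw_measure p) {c. \<forall>k<c []. subtree [k] c \<in> S} = pgf p (measure (gw_measure p) S)"
proof -
  interpret prob_space "gw_measure p" by (rule prob_space_gw_measure)
  define B where "B j = {c. c [] = j \<and> (\<forall>k<j. subtree [k] c \<in> S)}" for j
  note [measurable] = S
  have B: "B j \<in> sets (gw_measure p)" for j
  proof -
    have "Measurable.pred (gw_measure p) (\<lambda>c. c [] = j \<and> (\<forall>k<j. c \<in> subtree [k] -` S \<inter> space (gw_measure p)))"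
      by measurable
    then show ?thesis by (simp add: pred_def B_def)
  qed
  have *: "{c. \<forall>k<c []. subtree [k] c \<in> S} = (\<Union>j. B j)" by (auto simp: B_def)
  have "prob {c. \<forall>k<c []. subtree [k] c \<in> S} = prob (\<Union>j\<in>set_pmf p. B j)"
  proof (rule measure_eq_AE)
    show "AE c in gw_measure p. (c \<in> {c. \<forall>k<c []. subtree [k] c \<in> S}) = (c \<in> (\<Union>j\<in>set_pmf p. B j))"
      using AE_gw_offspring by eventually_elim (auto simp: B_def)
  qed (use B fin in \<open>auto simp: *\<close>)
  also have "\<dots> = (\<Sum>j\<in>set_pmf p. prob (B j))"
    using B fin by (intro finite_measure_finite_Union) (auto simp: disjoint_family_on_def B_def)
  also have "\<dots> = pgf p (prob S)"
    unfolding B_def pgf_def measure_gw_branching[OF S] ..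
  finally show ?thesis .
qed

section \<open>Full subtrees at infinitely many levels\<close>

lemma frequently_sequentially_Suc:
  "(\<exists>\<^sub>F n in sequentially. P (Suc n)) \<Longrightarrow> (\<exists>\<^sub>F n in sequentially. P n)"
  unfolding frequently_sequentially by (blast intro: le_SucI)

text \<open>The event is the intersection of the decreasing events \<open>B m\<close>, and
  \<open>B m\<close> contains the event \<open>P m\<close>, so the lower bound survives by
  continuity of the measure.\<close>

lemma (in prob_space) prob_frequently_ge:
  assumes meas: "\<And>n. {x\<in>space M. P n x} \<in> events"
    and ge: "eventually (\<lambda>n. \<delta> \<le> prob {x\<in>space M. P n x}) sequentially"
  shows "\<delta> \<le> prob {x\<in>space M. \<exists>\<^sub>F n in sequentially. P n x}"
proof -
  define B where "B m = {x\<in>space M. \<exists>n\<ge>m. P n x}" for m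
  have Bm: "B m \<in> events" for m
  proof -
    have "B m = (\<Union>n\<in>{m..}. {x\<in>space M. P n x})" by (auto simp: B_def)
    then show ?thesis using meas by auto
  qed
  have "decseq B" unfolding monotone_on_def B_def by (auto intro: order_trans)
  then have "(\<lambda>m. prob (B m)) \<longlonglongrightarrow> prob (\<Inter>m. B m)"
    using Bm by (intro finite_Lim_measure_decseq) auto
  moreover have "\<exists>N. \<forall>m\<ge>N. \<delta> \<le> prob (B m)"
  proof -
    obtain N where N: "\<And>n. n \<ge> N \<Longrightarrow> \<delta> \<le> prob {x\<in>space M. P n x}"
      using ge unfolding eventually_sequentially by blast
    have "\<delta> \<le> prob (B m)" if "m \<ge> N" for m
    proof -
      have "prob {x\<in>space M. P m x} \<le> prob (B m)"
        by (rule finite_measure_mono[OF _ Bm]) (auto simp: B_def)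
      with N[OF that] show ?thesis by linarith
    qed
    then show ?thesis by blast
  qed
  ultimately have "\<delta> \<le> prob (\<Inter>m. B m)" by (rule LIMSEQ_le_const)
  also have "(\<Inter>m. B m) = {x\<in>space M. \<exists>\<^sub>F n in sequentially. P n x}"
    by (auto simp: B_def frequently_sequentially)
  finally show ?thesis .
qed

section \<open>Probabilities of extinction and of full subtrees\<close>

locale supercritical_offspring =
  fixes p :: "nat pmf" and N :: nat
  assumes finite_offspring: "finite (set_pmf p)"
    and supercritical: "measure_pmf.expectation p real > 1"
    and N_def: "N = Max (set_pmf p)"
begin

lemma N_in: "N \<in> set_pmf p"
  unfolding N_def by (rule Max_in[OF finite_offspring set_pmf_not_empty])

lemma le_N: "k \<in> set_pmf p \<Longrightarrow> k \<le> N"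
  unfolding N_def by (rule Max_ge[OF finite_offspring])

lemma N_ge_2: "N \<ge> 2"
proof -
  have "measure_pmf.expectation p real \<le> real N"
    using finite_offspring le_N
    by (intro measure_pmf.integral_le_const integrable_measure_pmf_finite AE_pmfI) auto
  with supercritical show ?thesis by linarith
qed

sublocale prob_space "gw_measure p" by (rule prob_space_gw_measure)

definition extinction :: real where
  "extinction = prob {c. finite (gw_tree c)}"

definition full_prob :: "nat \<Rightarrow> real" where
  "full_prob K = prob {c. full_to_depth N K c}"

lemma event_Collect: "Measurable.pred (gw_measure p) P \<Longrightarrow> {c. P c} \<in> events"
  by (simp add: pred_def)

lemma extinction_fixed_point: "pgf p extinction = extinction"
proof -
  have "extinction = prob {c. \<forall>k<c []. subtree [k] c \<in> {c. finite (gw_tree c)}}"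
    unfolding extinction_def by (subst finite_gw_tree_iff) simp
  also have "\<dots> = pgf p extinction"
    unfolding extinction_def
    by (rule measure_gw_all_children[OF finite_offspring]) (intro event_Collect, measurable)
  finally show ?thesis ..
qed

lemma prob_not:
  assumes "Measurable.pred (gw_measure p) P"
  shows "prob {c. \<not> P c} = 1 - prob {c. P c}"
  using prob_compl[OF event_Collect[OF assms]] by (simp add: Collect_neg_eq Compl_eq_Diff_UNIV)

lemma full_prob_0: "full_prob 0 = 1 - extinction"
  unfolding full_prob_def extinction_def full_to_depth.simps
  by (rule prob_not) measurable

lemma full_prob_Suc: "full_prob (Suc K) = pmf p N * full_prob K ^ N"
  using measure_gw_branching[of "{c. full_to_depth N K c}" p N] event_Collect[OF measurable_full_to_depth]
  by (simp add: full_prob_def)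

text \<open>With \<open>a = pmf p N * (1 - extinction)\<close>, each further level raises the bound
  to the power \<open>N\<close> and costs one more factor \<open>a\<close>. The exponent
  \<open>e\<close> becomes \<open>N * e + 1\<close>, and \<open>(N + 1) ^ K\<close> dominates its
  iterates.\<close>

lemma full_prob_ge:
  assumes "extinction < 1"
  obtains a where "0 < a" "a \<le> 1" "\<And>K. a ^ ((N + 1) ^ K) \<le> full_prob K"
proof -
  define a where "a = pmf p N * (1 - extinction)"
  have ext: "0 \<le> extinction" by (simp add: extinction_def)
  have pN: "0 < pmf p N" "pmf p N \<le> 1" using N_in by (auto simp: pmf_positive pmf_le_1)
  have a: "0 < a" "a \<le> 1" "a \<le> pmf p N" "a \<le> 1 - extinction"
    using assms ext pN by (auto simp: a_def mult_le_one mult_left_le mult_left_le_one_le)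
  have "a ^ ((N + 1) ^ K) \<le> full_prob K" for K
  proof (induction K)
    case 0
    then show ?case using a by (simp add: full_prob_0)
  next
    case (Suc K)
    have "N * (N + 1) ^ K + 1 \<le> (N + 1) ^ Suc K" by simp
    then have "a ^ ((N + 1) ^ Suc K) \<le> a ^ (N * (N + 1) ^ K + 1)"
      using a by (intro power_decreasing) auto
    also have "\<dots> = a * (a ^ ((N + 1) ^ K)) ^ N" by (simp add: power_mult mult.commute flip: power_mult)
    also have "\<dots> \<le> pmf p N * full_prob K ^ N"
      using Suc a by (intro mult_mono power_mono) auto
    finally show ?case by (simp add: full_prob_Suc)
  qed
  with a that show thesis by blast
qed

section \<open>Amplification along the levels\<close>

definition level_prob :: "nat \<Rightarrow> nat \<Rightarrow> real" where
  "level_prob n K = prob {c. full_at_level N n K c}"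

lemma level_prob_0: "level_prob 0 K = full_prob K"
  by (simp add: level_prob_def full_prob_def full_at_level_0)

text \<open>Level \<open>Suc n\<close> lacks a full subtree exactly when level \<open>n\<close> of
  every child subtree does, so \<open>pgf p\<close> iterates the failure probability.\<close>

lemma level_prob_Suc: "level_prob (Suc n) K = 1 - pgf p (1 - level_prob n K)"
proof -
  have "1 - level_prob (Suc n) K = prob {c. \<not> full_at_level N (Suc n) K c}"
    unfolding level_prob_def by (rule prob_not[symmetric]) measurable
  also have "\<dots> = prob {c. \<forall>k<c []. subtree [k] c \<in> {c. \<not> full_at_level N n K c}}"
    by (simp add: full_at_level_Suc)
  also have "\<dots> = pgf p (prob {c. \<not> full_at_level N n K c})"
    by (rule measure_gw_all_children[OF finite_offspring]) (intro event_Collect, measurable)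
  also have "prob {c. \<not> full_at_level N n K c} = 1 - level_prob n K"
    unfolding level_prob_def by (rule prob_not) measurable
  finally show ?thesis by simp
qed

text \<open>The slope of \<open>x \<mapsto> 1 - pgf p (1 - x)\<close> at \<open>0\<close> is the mean offspring, so a small
  \<open>full_prob K\<close> is amplified exponentially in the level until it reaches a fixed size.\<close>

lemma level_prob_ge:
  obtains \<mu> \<delta> where "\<mu> > 1" "\<delta> > 0" "\<And>n K. min \<delta> (\<mu> ^ n * full_prob K) \<le> level_prob n K"
proof -
  obtain \<mu> \<delta> where \<mu>: "\<mu> > 1" "0 < \<delta>" "\<delta> \<le> 1"
    and exp: "\<And>x. 0 \<le> x \<Longrightarrow> x \<le> \<delta> \<Longrightarrow> \<mu> * x \<le> 1 - pgf p (1 - x)"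
    using pgf_expanding_at_1[OF finite_offspring supercritical] by blast
  have "min \<delta> (\<mu> ^ n * full_prob K) \<le> level_prob n K" for n K
  proof (induction n)
    case 0
    then show ?case by (simp add: level_prob_0)
  next
    case (Suc n)
    \<comment> \<open>Truncation at \<open>\<delta>\<close> keeps \<open>x\<close> where the
      expansion is known. Once \<open>x = \<delta>\<close>, the bound persists because
      \<open>\<mu> * \<delta> \<ge> \<delta>\<close>; before that it grows by the factor
      \<open>\<mu>\<close>.\<close>
    define x where "x = min \<delta> (\<mu> ^ n * full_prob K)"
    have x: "0 \<le> x" "x \<le> \<delta>" using \<mu> by (auto simp: x_def full_prob_def)
    have "min \<delta> (\<mu> ^ Suc n * full_prob K) \<le> \<mu> * x"
    proof (cases "x = \<delta>")
      case True
      have "\<delta> \<le> \<mu> * \<delta>" using \<mu> by simp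
      with True show ?thesis by simp
    next
      case False
      then have "x = \<mu> ^ n * full_prob K" by (auto simp: x_def min_def split: if_splits)
      then show ?thesis by (simp add: mult.assoc)
    qed
    also have "\<dots> \<le> 1 - pgf p (1 - x)" by (rule exp[OF x])
    also have "\<dots> \<le> 1 - pgf p (1 - level_prob n K)"
      using Suc by (intro diff_left_mono pgf_mono) (auto simp: x_def level_prob_def)
    finally show ?case by (simp add: level_prob_Suc)
  qed
  with \<mu> that show thesis by blast
qed

text \<open>This is the constant \<open>C\<close> of the theorem. The factor 1/2 makes
  \<open>(N + 1) ^ depth n\<close> at most \<open>sqrt n\<close>, so that full subtrees of this
  depth have probability at least \<open>a powr sqrt n\<close>.\<close>

definition depth_rate :: real where
  "depth_rate = ln 2 / (2 * ln (real N + 1))"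

definition depth :: "nat \<Rightarrow> nat" where
  "depth n = nat \<lfloor>depth_rate / ln 2 * ln (real n)\<rfloor>"

lemma depth_rate_pos: "depth_rate > 0"
  using N_ge_2 by (simp add: depth_rate_def)

lemma depth_mono: "1 \<le> m \<Longrightarrow> m \<le> n \<Longrightarrow> depth m \<le> depth n"
  unfolding depth_def using depth_rate_pos
  by (intro nat_mono floor_mono mult_left_mono) auto

lemma power_depth_le:
  assumes "n \<ge> 1"
  shows "real (N + 1) ^ depth n \<le> sqrt n"
proof -
  have L: "ln (real N + 1) > 0" using N_ge_2 by simp
  have "real (depth n) \<le> depth_rate / ln 2 * ln n"
    unfolding depth_def using assms depth_rate_pos by (intro of_nat_floor mult_nonneg_nonneg) auto
  then have "real (depth n) * ln (real N + 1) \<le> ln n / 2"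
    using L by (simp add: depth_rate_def field_simps)
  then have "exp (real (depth n) * ln (real N + 1)) \<le> exp (ln n / 2)" by simp
  moreover have "exp (real (depth n) * ln (real N + 1)) = real (N + 1) ^ depth n"
    by (simp add: exp_of_nat_mult add.commute)
  moreover have "exp (ln n / 2) = sqrt n"
    using assms exp_ln[of "sqrt n"] by (simp add: ln_sqrt)
  ultimately show ?thesis by simp
qed

text \<open>The factor \<open>\<mu> ^ n\<close> gained over \<open>n\<close> levels outweighs the
  cost \<open>a powr sqrt (2 * n)\<close> of the depth. The doubled argument of \<open>depth\<close>
  leaves room for the level shifts in \<open>often_full\<close>.\<close>

lemma level_prob_depth_bounded_below:
  assumes "extinction < 1"
  obtains \<delta> where "\<delta> > 0" "eventually (\<lambda>n. \<delta> \<le> level_prob n (depth (2 * n))) sequentially"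
proof -
  obtain \<mu> \<delta> where \<mu>: "\<mu> > 1" "\<delta> > 0"
    and level: "\<And>n K. min \<delta> (\<mu> ^ n * full_prob K) \<le> level_prob n K"
    using level_prob_ge by blast
  obtain a where a: "0 < a" "a \<le> 1" "\<And>K. a ^ ((N + 1) ^ K) \<le> full_prob K"
    using full_prob_ge[OF assms] by blast
  \<comment> \<open>The threshold is the inequality
    \<open>sqrt (2 * n) * (- ln a) \<le> n * ln \<mu>\<close>, squared and solved for
    \<open>n\<close>.\<close>
  have "eventually (\<lambda>n. 2 * (ln a / ln \<mu>)\<^sup>2 \<le> real n) sequentially"
    using filterlim_real_sequentially by (simp add: filterlim_at_top)
  then have "eventually (\<lambda>n. 1 \<le> \<mu> ^ n * full_prob (depth (2 * n))) sequentially"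
    using eventually_ge_at_top[of 1]
  proof eventually_elim
    case (elim n)
    have "(sqrt (2 * n) * (- ln a))\<^sup>2 = 2 * real n * (ln a)\<^sup>2" by (simp add: power_mult_distrib)
    also have "\<dots> = real n * (2 * (ln a / ln \<mu>)\<^sup>2) * (ln \<mu>)\<^sup>2" using \<mu> by (simp add: power_divide)
    also have "\<dots> \<le> real n * real n * (ln \<mu>)\<^sup>2"
      using elim by (intro mult_right_mono mult_left_mono) auto
    also have "\<dots> = (real n * ln \<mu>)\<^sup>2" by (simp add: power2_eq_square)
    finally have "sqrt (2 * n) * (- ln a) \<le> real n * ln \<mu>"
      by (rule power2_le_imp_le) (use \<mu> in simp)
    then have "1 \<le> exp (real n * ln \<mu> + sqrt (2 * n) * ln a)" by simp
    also have "\<dots> = \<mu> ^ n * a powr sqrt (2 * n)"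
      using \<mu> a by (simp add: exp_add exp_of_nat_mult powr_def)
    also have "\<dots> \<le> \<mu> ^ n * a powr real ((N + 1) ^ depth (2 * n))"
      using power_depth_le[of "2 * n"] elim \<mu> a by (intro mult_left_mono powr_mono') auto
    also have "\<dots> = \<mu> ^ n * a ^ ((N + 1) ^ depth (2 * n))"
      using a by (subst powr_realpow) auto
    also have "\<dots> \<le> \<mu> ^ n * full_prob (depth (2 * n))"
      using a \<mu> by (intro mult_left_mono) auto
    finally show ?case .
  qed
  then have "eventually (\<lambda>n. min \<delta> 1 \<le> level_prob n (depth (2 * n))) sequentially"
  proof eventually_elim
    case (elim n)
    then show ?case using level[of n "depth (2 * n)"] by linarith
  qed
  with \<mu> show thesis by (intro that[of "min \<delta> 1"]) auto
qed

text \<open>Allowing every shift \<open>l\<close> of the level makes the property pass from the subtree of a child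
  of the root to the whole tree.\<close>

definition often_full :: "(nat list \<Rightarrow> nat) \<Rightarrow> bool" where
  "often_full c \<longleftrightarrow> (\<forall>l. \<exists>\<^sub>F n in sequentially. full_at_level N n (depth (n + l)) c)"

lemma measurable_often_full [measurable]: "Measurable.pred (gw_measure p) often_full"
  unfolding often_full_def frequently_sequentially by measurable

lemma often_full_child:
  assumes "k < c []" "often_full (subtree [k] c)"
  shows "often_full c"
  unfolding often_full_def
proof
  fix l
  \<comment> \<open>The child needs the shift \<open>Suc l\<close>: its level \<open>n\<close> is
    level \<open>Suc n\<close> of the whole tree, and \<open>n + Suc l = Suc n + l\<close>.\<close>
  have "\<exists>\<^sub>F n in sequentially. full_at_level N n (depth (n + Suc l)) (subtree [k] c)"
    using assms(2) by (simp only: often_full_def)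
  then have "\<exists>\<^sub>F n in sequentially. full_at_level N (Suc n) (depth (Suc n + l)) c"
    by (rule frequently_elim1) (use assms(1) in \<open>auto simp: full_at_level_Suc\<close>)
  then show "\<exists>\<^sub>F n in sequentially. full_at_level N n (depth (n + l)) c"
    by (rule frequently_sequentially_Suc)
qed

text \<open>The depths \<open>depth (2 * n)\<close> serve every shift \<open>l\<close> at once,
  since \<open>n + l \<le> 2 * n\<close> as soon as \<open>n \<ge> l\<close>, and a full subtree
  contains those of smaller depth.\<close>

lemma prob_often_full_pos:
  assumes "extinction < 1"
  shows "0 < prob {c. often_full c}"
proof -
  obtain \<delta> where \<delta>: "\<delta> > 0" "eventually (\<lambda>n. \<delta> \<le> level_prob n (depth (2 * n))) sequentially"
    using level_prob_depth_bounded_below[OF assms] by blast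
  have "\<delta> \<le> prob {c\<in>space (gw_measure p). \<exists>\<^sub>F n in sequentially. full_at_level N n (depth (2 * n)) c}"
    using \<delta>(2) by (intro prob_frequently_ge) (auto simp: level_prob_def intro!: event_Collect)
  also have "\<dots> \<le> prob {c. often_full c}"
  proof (rule finite_measure_mono)
    show "{c\<in>space (gw_measure p). \<exists>\<^sub>F n in sequentially. full_at_level N n (depth (2 * n)) c}
        \<subseteq> {c. often_full c}"
    proof (clarsimp simp: often_full_def)
      fix c l assume "\<exists>\<^sub>F n in sequentially. full_at_level N n (depth (2 * n)) c"
      then have "\<exists>\<^sub>F n in sequentially. full_at_level N n (depth (2 * n)) c \<and> (1 \<le> n \<and> l \<le> n)"
        by (intro frequently_eventually_frequently eventually_conj eventually_ge_at_top)
      then show "\<exists>\<^sub>F n in sequentially. full_at_level N n (depth (n + l)) c"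
      proof (rule frequently_elim1)
        fix n assume n: "full_at_level N n (depth (2 * n)) c \<and> (1 \<le> n \<and> l \<le> n)"
        then have "depth (n + l) \<le> depth (2 * n)" by (intro depth_mono) auto
        with n N_ge_2 show "full_at_level N n (depth (n + l)) c"
          by (intro full_at_level_antimono[of N "depth (n + l)" "depth (2 * n)"]) auto
      qed
    qed
    show "{c. often_full c} \<in> events" by (intro event_Collect) measurable
  qed
  finally show ?thesis using \<delta>(1) by simp
qed

text \<open>Failure contains extinction, and by inheritance its probability \<open>y\<close>
  satisfies \<open>y \<le> pgf p y\<close>. If survival is possible then \<open>y < 1\<close>, and
  convexity excludes values strictly between \<open>extinction\<close> and 1. Hence failure and
  extinction differ by a null set.\<close>

lemma AE_often_full: "AE c in gw_measure p. infinite (gw_tree c) \<longrightarrow> often_full c"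
proof -
  define y where "y = prob {c. \<not> often_full c}"
  have fin_ev: "{c. finite (gw_tree c)} \<in> events" by (intro event_Collect) measurable
  have not_ev: "{c. \<not> often_full c} \<in> events" by (intro event_Collect) measurable
  have sub: "{c. finite (gw_tree c)} \<subseteq> {c. \<not> often_full c}"
  proof clarify
    fix c assume "finite (gw_tree c)" "often_full c"
    then obtain n where "full_at_level N n (depth (n + 0)) c"
      unfolding often_full_def by (blast dest: frequently_ex)
    with full_at_level_infinite[of N] N_ge_2 \<open>finite (gw_tree c)\<close> show False by fastforce
  qed
  have "y \<le> extinction"
  proof (cases "extinction < 1")
    case True
    have "y = 1 - prob {c. often_full c}" unfolding y_def by (rule prob_not) measurable
    then have "y < 1" using prob_often_full_pos[OF True] by simp
    have "y \<le> prob {c. \<forall>k<c []. subtree [k] c \<in> {c. \<not> often_full c}}"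
      unfolding y_def
    proof (rule finite_measure_mono)
      show "{c. \<forall>k<c []. subtree [k] c \<in> {c. \<not> often_full c}} \<in> events"
        by (intro event_Collect) measurable
    qed (use often_full_child in auto)
    also have "\<dots> = pgf p y"
      unfolding y_def by (rule measure_gw_all_children[OF finite_offspring not_ev])
    finally have "\<not> pgf p y < y" by simp
    then have "\<not> extinction < y"
      using pgf_less_above_fixed_point[OF finite_offspring N_in N_ge_2 extinction_fixed_point _ _ \<open>y < 1\<close>]
      by (auto simp: extinction_def)
    then show ?thesis by simp
  qed (use prob_le_1 in \<open>auto simp: y_def intro: order_trans\<close>)
  moreover have "prob ({c. \<not> often_full c} - {c. finite (gw_tree c)}) = y - extinction"
    unfolding y_def extinction_def using not_ev fin_ev sub by (rule finite_measure_Diff)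
  ultimately have "prob ({c. \<not> often_full c} - {c. finite (gw_tree c)}) = 0"
    using measure_nonneg[of "gw_measure p" "{c. \<not> often_full c} - {c. finite (gw_tree c)}"] by linarith
  then have "{c. \<not> often_full c} - {c. finite (gw_tree c)} \<in> null_sets (gw_measure p)"
    using not_ev fin_ev by (intro null_setsI) (auto simp: emeasure_eq_measure)
  then show ?thesis by (rule AE_I') auto
qed

end

section \<open>Transfer to the given offspring variables\<close>

theorem corollary2p4:
  fixes M :: "'w measure"
    and X :: "nat list \<Rightarrow> 'w \<Rightarrow> nat"
    and \<theta> :: "nat pmf"
  assumes "prob_space M"
    and "prob_space.indep_vars M (\<lambda>_. count_space UNIV) X UNIV"
    and "\<And>v. distr M (count_space UNIV) (X v) = measure_pmf \<theta>"
    and "finite (set_pmf \<theta>)"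
    and "measure_pmf.expectation \<theta> real > 1"
  shows "\<exists>C>0.
    AE \<omega> in uniform_measure M {\<omega> \<in> space M. infinite (gw_tree (\<lambda>v. X v \<omega>))}.
      \<forall>\<phi>. dimension_function \<phi>
          \<and> filterlim (\<lambda>x. \<phi> x * \<bar>ln x\<bar>) at_top (at_right 0)
          \<and> eventually (\<lambda>x. \<phi> x \<le> C * (ln \<bar>ln x\<bar> / \<bar>ln x\<bar>)) (at_right 0)
        \<longrightarrow> assouad_dim_at \<phi> (gromov_boundary (gw_tree (\<lambda>v. X v \<omega>))) gromov_dist
            = assouad_dim (gromov_boundary (gw_tree (\<lambda>v. X v \<omega>))) gromov_dist"
proof -
  interpret offspring: supercritical_offspring \<theta> "Max (set_pmf \<theta>)"
    by unfold_locales (use assms(4,5) in auto)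
  interpret prob_space M by (rule assms(1))
  let ?N = "Max (set_pmf \<theta>)"
  let ?C = offspring.depth_rate
  let ?c = "\<lambda>\<omega> v. X v \<omega>"
  have X [measurable]: "X v \<in> measurable M (count_space UNIV)" for v
    using assms(2) by (auto simp: indep_vars_def)
  have c_meas [measurable]: "?c \<in> measurable M (gw_measure \<theta>)"
    unfolding gw_measure_def by (rule measurable_PiM_single') auto
  \<comment> \<open>Independence with common law \<open>\<theta>\<close> makes the joint law the
    product measure, so almost sure properties under \<open>gw_measure \<theta>\<close> carry over
    to \<open>M\<close>.\<close>
  have law: "distr M (gw_measure \<theta>) ?c = gw_measure \<theta>"
  proof -
    have "distr M (PiM UNIV (\<lambda>_. count_space UNIV)) (\<lambda>\<omega>. \<lambda>v\<in>UNIV. X v \<omega>) = gw_measure \<theta>"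
      using assms(2) by (subst (asm) indep_vars_iff_distr_eq_PiM') (simp_all add: assms(3) gw_measure_def)
    then show ?thesis
      by (simp add: restrict_UNIV sets_gw_measure cong: distr_cong)
  qed
  have transfer: "AE \<omega> in M. P (?c \<omega>)" if "AE c in gw_measure \<theta>. P c" for P
    by (rule AE_distrD[OF c_meas]) (unfold law, rule that)
  have infinite_event: "{\<omega> \<in> space M. infinite (gw_tree (?c \<omega>))} \<in> events"
    using measurable_compose[OF c_meas measurable_finite_gw_tree] by (simp add: pred_def) measurable
  have "AE \<omega> in M. infinite (gw_tree (?c \<omega>)) \<longrightarrow> offspring.often_full (?c \<omega>)"
    by (rule transfer[OF offspring.AE_often_full])
  moreover have "AE \<omega> in M. \<forall>v. X v \<omega> \<in> set_pmf \<theta>"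
    by (rule transfer[OF AE_gw_offspring])
  \<comment> \<open>Neither of the two almost sure properties mentions \<open>\<phi>\<close>, so one
    null set serves the uncountably many dimension functions.\<close>
  ultimately have "AE \<omega> in M. \<omega> \<in> {\<omega> \<in> space M. infinite (gw_tree (?c \<omega>))} \<longrightarrow>
      (\<forall>\<phi>. dimension_function \<phi>
          \<and> filterlim (\<lambda>x. \<phi> x * \<bar>ln x\<bar>) at_top (at_right 0)
          \<and> eventually (\<lambda>x. \<phi> x \<le> ?C * (ln \<bar>ln x\<bar> / \<bar>ln x\<bar>)) (at_right 0)
        \<longrightarrow> assouad_dim_at \<phi> (gromov_boundary (gw_tree (?c \<omega>))) gromov_dist
            = assouad_dim (gromov_boundary (gw_tree (?c \<omega>))) gromov_dist)"
  proof eventually_elim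
    case (elim \<omega>)
    show ?case
    proof (intro impI allI, elim conjE)
      fix \<phi> :: "real \<Rightarrow> real"
      let ?S = "gromov_boundary (gw_tree (?c \<omega>))"
      assume inf: "\<omega> \<in> {\<omega> \<in> space M. infinite (gw_tree (?c \<omega>))}"
        and \<phi>: "dimension_function \<phi>"
        and lim: "filterlim (\<lambda>x. \<phi> x * \<bar>ln x\<bar>) at_top (at_right 0)"
        and bound: "eventually (\<lambda>x. \<phi> x \<le> ?C * (ln \<bar>ln x\<bar> / \<bar>ln x\<bar>)) (at_right 0)"
      have "\<exists>\<^sub>F n in sequentially. full_at_level ?N n (offspring.depth (n + 0)) (?c \<omega>)"
        using elim(1) inf unfolding offspring.often_full_def by blast
      then have "\<exists>\<^sub>F n in sequentially. full_at_level ?N n (nat \<lfloor>?C / ln 2 * ln (real n)\<rfloor>) (?c \<omega>)"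
        by (simp add: offspring.depth_def)
      then have "ereal (log 2 ?N) \<le> assouad_dim_at \<phi> ?S gromov_dist"
        by (rule assouad_dim_at_gromov_ge[OF offspring.N_ge_2 _ offspring.depth_rate_pos lim bound])
      moreover have "assouad_dim ?S gromov_dist \<le> ereal (log 2 ?N)"
        using offspring.N_ge_2 offspring.le_N elim(2) by (intro assouad_dim_gromov_le) auto
      moreover have "assouad_dim_at \<phi> ?S gromov_dist \<le> assouad_dim ?S gromov_dist"
        using \<phi> by (intro assouad_dim_at_le_assouad_dim) (auto simp: dimension_function_def)
      ultimately show "assouad_dim_at \<phi> ?S gromov_dist = assouad_dim ?S gromov_dist" by order
    qed
  qed
  from offspring.depth_rate_pos AE_uniform_measureI[OF infinite_event this]
  show ?thesis by (intro exI[of _ ?C] conjI)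
qed

end
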